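(* Let $n$ be a positive integer and let $k$ be a real number with $2 \le k \le \frac{1}{648}\log\log\log n$. Let $G$ be an $n$-vertex graph satisfying: (i) $G$ has average degree at least $k$ and maximum degree at most $6k$; (ii) $G$ has girth at least $\log n/(6k)^2$; (iii) every $t$-vertex subgraph $H$ of $G$ with $t\ge \log n/(6k)^2$ satisfies $\mathrm{sep}_V(H) \le \mathrm{sep}_E(H)\le \frac{t}{\log t}(\log\log t)^2$. Then for every $t$-vertex subgraph $H$ of $G$ with $t\ge \log n/(6k)^2$, and every real $\mu$ with $1/t \le \mu \le 2/3$, there are $\left\lceil \frac{1}{4\mu}\right\rceil$ mutually disjoint subsets $A_i \subseteq V(H)$ of size $\mu t/3 \le |A_i| \le \mu t$ satisfying $$\phi_H(A_i) \le \frac{\log (1/\mu)}{\log t}\cdot(14\log\log t)^2 .$$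
   Context: Graphs are finite, simple and undirected; subgraphs are not necessarily induced; $\log$ denotes $\log_2$. The girth of a graph is the minimum length of a cycle in it. An edge separator in a graph $G=(V,E)$ is a set $F\subseteq E$ for which there is a partition $V=A\cup B$ with $|A|,|B|\le\frac23|V|$ and no edge of $E\setminus F$ between $A$ and $B$; $\mathrm{sep}_E(G)$ is the minimum cardinality of an edge separator. A vertex separator is a set $S\subseteq V$ such that $V\setminus S$ can be partitioned into two sets $A,B$ with $|A|,|B|\le\frac23|V|$ and no edge of $G$ between $A$ and $B$; $\mathrm{sep}_V(G)$ is the minimum cardinality of a vertex separator. For a graph $H$ and a subset $\emptyset\ne A\subseteq V(H)$, $\partial_H(A)$ is the set of edges of $H$ with precisely one endpoint in $A$, and $\phi_H(A)=|\partial_H(A)|/|A|$ is the edge expansion of $A$ in $H$. *)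

theory Defs
  imports Complex_Main "HOL-Library.Extended_Real" "HOL-Library.Disjoint_Sets"
begin

record 'a graph =
  verts :: "'a set"
  edges :: "'a set set"

definition simple_graph :: "'a graph \<Rightarrow> bool" where
  "simple_graph G \<longleftrightarrow> finite (verts G) \<and> (\<forall>e\<in>edges G. e \<subseteq> verts G \<and> card e = 2)"

definition subgraph :: "'a graph \<Rightarrow> 'a graph \<Rightarrow> bool" where
  "subgraph H G \<longleftrightarrow> simple_graph H \<and> verts H \<subseteq> verts G \<and> edges H \<subseteq> edges G"

definition vertex_degree :: "'a graph \<Rightarrow> 'a \<Rightarrow> nat" where
  "vertex_degree G v = card {e \<in> edges G. v \<in> e}"

(* The next two are meaningful only if the vertex set is nonempty (and finite). *)

definition average_degree :: "'a graph \<Rightarrow> real" where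
  "average_degree G = (\<Sum>v\<in>verts G. real (vertex_degree G v)) / real (card (verts G))"

definition max_degree :: "'a graph \<Rightarrow> nat" where
  "max_degree G = Max (vertex_degree G ` verts G)"

(* A cycle is given by its vertices in cyclic order, so its length is the length of the list. *)

definition is_cycle :: "'a graph \<Rightarrow> 'a list \<Rightarrow> bool" where
  "is_cycle G c \<longleftrightarrow> 3 \<le> length c \<and> distinct c \<and> set c \<subseteq> verts G \<and>
     (\<forall>i<length c. {c ! i, c ! (Suc i mod length c)} \<in> edges G)"

(* The infimum of the empty set is infinity: acyclic graphs have infinite girth. *)

definition girth :: "'a graph \<Rightarrow> enat" where
  "girth G = Inf {enat (length c) | c. is_cycle G c}"

definition edge_separator :: "'a graph \<Rightarrow> 'a set set \<Rightarrow> bool" where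
  "edge_separator G F \<longleftrightarrow> F \<subseteq> edges G \<and>
     (\<exists>A B. A \<union> B = verts G \<and> A \<inter> B = {} \<and>
        real (card A) \<le> 2 / 3 * real (card (verts G)) \<and>
        real (card B) \<le> 2 / 3 * real (card (verts G)) \<and>
        (\<forall>a\<in>A. \<forall>b\<in>B. {a, b} \<notin> edges G - F))"

definition vertex_separator :: "'a graph \<Rightarrow> 'a set \<Rightarrow> bool" where
  "vertex_separator G S \<longleftrightarrow> S \<subseteq> verts G \<and>
     (\<exists>A B. A \<union> B = verts G - S \<and> A \<inter> B = {} \<and>
        real (card A) \<le> 2 / 3 * real (card (verts G)) \<and>
        real (card B) \<le> 2 / 3 * real (card (verts G)) \<and>
        (\<forall>a\<in>A. \<forall>b\<in>B. {a, b} \<notin> edges G))"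

(* A one-vertex graph has no edge separator, so sep_E is unspecified there; every other
   finite graph has one, and every finite graph has a vertex separator. *)

definition sep_E :: "'a graph \<Rightarrow> nat" where
  "sep_E G = Min {card F | F. edge_separator G F}"

definition sep_V :: "'a graph \<Rightarrow> nat" where
  "sep_V G = Min {card S | S. vertex_separator G S}"

definition edge_boundary :: "'a graph \<Rightarrow> 'a set \<Rightarrow> 'a set set" where
  "edge_boundary H A = {e \<in> edges H. card (e \<inter> A) = 1}"

definition edge_expansion :: "'a graph \<Rightarrow> 'a set \<Rightarrow> real" where
  "edge_expansion H A = real (card (edge_boundary H A)) / real (card A)"

end

theory Submission
  imports Defs
begin

text \<open>
  If \<open>\<mu> t \<le> sqrt t\<close>, then \<open>log (1/\<mu>) / log t \<ge> 1/2\<close>, and the maximum degree of \<open>G\<close>, which is at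
  most \<open>6k \<le> log log t\<close>, already bounds the expansion of every set. Otherwise split \<open>V(H)\<close>
  recursively by balanced edge separators until every part has at most \<open>\<mu> t\<close> vertices. Each set that
  is split has more than \<open>sqrt t\<close> vertices, so cutting it costs at most \<open>K = 2 (log log t)^2 / log t\<close>
  edges per vertex: by hypothesis (iii) if it is large, and otherwise because it induces a forest,
  which has a balanced cut all of whose edges share a vertex. There are \<open>O(log (1/\<mu>))\<close> levels of
  recursion, which bounds the sum of the boundaries of the parts, and by averaging at least
  \<open>1/(4\<mu>)\<close> of the parts have small expansion.
\<close>

section \<open>Edges, cycles and balanced cuts of forests\<close>

lemma finite_edges:
  assumes "simple_graph G" shows "finite (edges G)"
proof -
  have "edges G \<subseteq> Pow (verts G)" "finite (verts G)"
    using assms by (auto simp: simple_graph_def)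
  then show ?thesis by (meson finite_Pow_iff finite_subset)
qed

lemma simple_graph_edgeE:
  assumes "simple_graph G" "e \<in> edges G"
  obtains x y where "e = {x, y}" "x \<noteq> y" "x \<in> verts G" "y \<in> verts G"
proof -
  have "card e = 2" "e \<subseteq> verts G"
    using assms by (auto simp: simple_graph_def)
  then show ?thesis using that by (auto simp: card_2_iff)
qed

text \<open>Take a longest path inside \<open>R\<close>. By maximality every neighbour in
  \<open>R\<close> of its first vertex lies on the path. One of them differs from the second vertex,
  and the path up to it closes to a cycle.\<close>

lemma min_degree_two_imp_cycle:
  assumes G: "simple_graph G" and R: "R \<subseteq> verts G" "R \<noteq> {}"
    and deg: "\<And>v. v \<in> R \<Longrightarrow> 2 \<le> card {w \<in> R. {v, w} \<in> edges G}"
  shows "\<exists>c. is_cycle G c \<and> set c \<subseteq> R"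
proof -
  define path where "path xs \<longleftrightarrow> xs \<noteq> [] \<and> distinct xs \<and> set xs \<subseteq> R \<and>
    (\<forall>i. Suc i < length xs \<longrightarrow> {xs ! i, xs ! Suc i} \<in> edges G)" for xs
  have finR: "finite R"
    using G R by (auto simp: simple_graph_def intro: finite_subset)
  obtain r where "r \<in> R" using R by auto
  then have "path [r]" by (auto simp: path_def)
  moreover have "\<forall>xs. path xs \<longrightarrow> length xs < Suc (card R)"
    unfolding path_def using finR by (metis card_mono distinct_card less_Suc_eq_le)
  ultimately obtain xs where xs: "path xs" "\<And>ys. path ys \<Longrightarrow> length ys \<le> length xs"
    using ex_has_greatest_nat[of path "[r]" length] by blast
  define v where "v = xs ! 0"
  have "v \<in> R" using xs(1) by (auto simp: path_def v_def)
  define N where "N = {w \<in> R. {v, w} \<in> edges G}"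
  have "2 \<le> card N" using deg[OF \<open>v \<in> R\<close>] by (simp add: N_def)
  have "finite N" using finR by (simp add: N_def)
  \<comment> \<open>On a path with a single vertex \<open>xs ! 1\<close> is unspecified. The
    argument only needs that one value cannot exhaust \<open>N\<close>; such a path is ruled out
    later by \<open>w \<noteq> v\<close>.\<close>
  have "\<not> N \<subseteq> {xs ! 1}"
  proof
    assume "N \<subseteq> {xs ! 1}"
    then have "card N \<le> card {xs ! 1}" by (intro card_mono) auto
    with \<open>2 \<le> card N\<close> show False by simp
  qed
  then obtain w where w: "w \<in> N" "w \<noteq> xs ! 1" by auto
  have "w \<noteq> v"
    using w G by (auto simp: N_def simple_graph_def)
  have "w \<in> set xs"
  proof (rule ccontr)
    assume "w \<notin> set xs"
    have "path (w # xs)"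
      unfolding path_def
    proof (intro conjI allI impI)
      show "distinct (w # xs)" "set (w # xs) \<subseteq> R"
        using xs(1) \<open>w \<notin> set xs\<close> w by (auto simp: path_def N_def)
      fix i assume "Suc i < length (w # xs)"
      then show "{(w # xs) ! i, (w # xs) ! Suc i} \<in> edges G"
        using xs(1) w by (cases i) (auto simp: path_def N_def v_def insert_commute)
    qed simp
    then show False using xs(2) by fastforce
  qed
  then obtain j where j: "j < length xs" "xs ! j = w" by (auto simp: in_set_conv_nth)
  have "2 \<le> j"
    using j w \<open>w \<noteq> v\<close> by (cases j rule: nat.exhaust; cases "j = 1") (auto simp: v_def)
  have "is_cycle G (take (Suc j) xs)"
    unfolding is_cycle_def
  proof (intro conjI allI impI)
    show "3 \<le> length (take (Suc j) xs)" using j \<open>2 \<le> j\<close> by simp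
    show "distinct (take (Suc j) xs)" using xs(1) by (simp add: path_def)
    show "set (take (Suc j) xs) \<subseteq> verts G"
      using xs(1) R set_take_subset[of "Suc j" xs] by (auto simp: path_def)
    fix i assume "i < length (take (Suc j) xs)"
    then have "i \<le> j" by simp
    show "{take (Suc j) xs ! i, take (Suc j) xs ! (Suc i mod length (take (Suc j) xs))} \<in> edges G"
    proof (cases "i = j")
      case True
      then show ?thesis using j w by (simp add: N_def v_def insert_commute)
    next
      case False
      then show ?thesis using j \<open>i \<le> j\<close> xs(1) by (simp add: path_def)
    qed
  qed
  moreover have "set (take (Suc j) xs) \<subseteq> R"
    using xs(1) set_take_subset[of "Suc j" xs] by (auto simp: path_def)
  ultimately show ?thesis by blast
qed

text \<open>
  The map \<open>c\<close> contracts the graph onto \<open>R\<close>: every edge that is not contracted joins two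
  representatives, so each boundary edge of a fibre contains its representative. Merging the fibre
  of a leaf of the contracted forest into that of its neighbour keeps this invariant, and the first
  fibre to reach a third of the vertices has at most two thirds of them.
\<close>
lemma forest_contraction_balanced_cut:
  assumes G: "simple_graph G"
    and leaf: "\<And>R. R \<subseteq> verts G \<Longrightarrow> R \<noteq> {} \<Longrightarrow> \<exists>v\<in>R. card {w \<in> R. {v, w} \<in> edges G} \<le> 1"
    and "verts G \<noteq> {}" "R \<subseteq> verts G" "c ` verts G \<subseteq> R"
    and "\<And>x y. {x, y} \<in> edges G \<Longrightarrow> c x = c y \<or> (c x = x \<and> c y = y)"
    and "\<And>r. r \<in> R \<Longrightarrow> 3 * card {x \<in> verts G. c x = r} < card (verts G)"
  shows "\<exists>A u. A \<subseteq> verts G \<and> u \<in> verts G \<and> card (verts G) \<le> 3 * card A \<and>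
           3 * card A \<le> 2 * card (verts G) \<and> edge_boundary G A \<subseteq> {e \<in> edges G. u \<in> e}"
  using assms(4-)
proof (induction "card R" arbitrary: R c rule: less_induct)
  case less
  note RV = less.prems(1) and cR = less.prems(2) and inv = less.prems(3) and small = less.prems(4)
  have finV: "finite (verts G)" using G by (simp add: simple_graph_def)
  have finR: "finite R" using RV finV by (rule finite_subset)
  have "R \<noteq> {}" using cR assms(3) by auto
  then obtain l where l: "l \<in> R" "card {w \<in> R. {l, w} \<in> edges G} \<le> 1"
    using leaf RV by blast
  define N where "N = {w \<in> R. {l, w} \<in> edges G}"
  have "l \<notin> N" using G by (auto simp: N_def simple_graph_def)
  have "finite N" "card N \<le> 1" using finR l by (auto simp: N_def)
  have "R \<noteq> {l}"
  proof
    assume "R = {l}"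
    then have "{x \<in> verts G. c x = l} = verts G" using cR by auto
    then show False using small[of l] l by simp
  qed
  \<comment> \<open>If \<open>l\<close> has no neighbour in \<open>R\<close>, any other
    representative serves as \<open>u\<close>: fibres need not be connected, so merging across
    components is harmless.\<close>
  have "\<exists>u\<in>R. u \<noteq> l \<and> N \<subseteq> {u}"
  proof (cases "N = {}")
    case True
    then show ?thesis using \<open>R \<noteq> {l}\<close> l by auto
  next
    case False
    then obtain u where "N = {u}"
      using \<open>finite N\<close> \<open>card N \<le> 1\<close>
      by (metis One_nat_def card_1_singletonE card_gt_0_iff le_antisym less_eq_Suc_le)
    then show ?thesis using \<open>l \<notin> N\<close> by (auto simp: N_def)
  qed
  then obtain u where u: "u \<in> R" "u \<noteq> l" "N \<subseteq> {u}" by blast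
  define c' where "c' x = (if c x = l then u else c x)" for x
  \<comment> \<open>An uncontracted edge that meets the fibre of \<open>l\<close> meets it in
    \<open>l\<close> itself, and its other end is a neighbour of \<open>l\<close> in
    \<open>R\<close>, hence \<open>u\<close>. So the merge contracts this edge and leaves every
    other uncontracted edge as it was.\<close>
  have inv': "c' x = c' y \<or> (c' x = x \<and> c' y = y)" if e: "{x, y} \<in> edges G" for x y
  proof -
    have V: "x \<in> verts G" "y \<in> verts G" using G e by (auto simp: simple_graph_def)
    have "{y, x} \<in> edges G" using e by (simp add: insert_commute)
    moreover have "c x \<in> R" "c y \<in> R" using cR V by auto
    ultimately show ?thesis
      using inv[OF e] e u by (auto simp: c'_def N_def)
  qed
  define A where "A = {x \<in> verts G. c' x = u}"
  have AV: "A \<subseteq> verts G" by (auto simp: A_def)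
  have "A = {x \<in> verts G. c x = u} \<union> {x \<in> verts G. c x = l}"
    using u by (auto simp: A_def c'_def)
  then have "card A \<le> card {x \<in> verts G. c x = u} + card {x \<in> verts G. c x = l}"
    by (simp add: card_Un_le)
  then have A2: "3 * card A \<le> 2 * card (verts G)"
    using small[of u] small[of l] u l by linarith
  show ?case
  proof (cases "card (verts G) \<le> 3 * card A")
    case True
    have "u \<in> e" if e: "e \<in> edge_boundary G A" for e
    proof -
      have eE: "e \<in> edges G" "card (e \<inter> A) = 1" using e by (auto simp: edge_boundary_def)
      obtain x y where xy: "e = {x, y}" "x \<noteq> y" "x \<in> verts G" "y \<in> verts G"
        using simple_graph_edgeE[OF G eE(1)] .
      show ?thesis
        using eE(2) inv'[of x y] eE(1) xy
        by (cases "x \<in> A"; cases "y \<in> A") (auto simp: A_def)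
    qed
    then have "edge_boundary G A \<subseteq> {e \<in> edges G. u \<in> e}" by (auto simp: edge_boundary_def)
    then show ?thesis using True A2 AV u RV by blast
  next
    case False
    show ?thesis
    proof (rule less.hyps[of "R - {l}" c'])
      show "card (R - {l}) < card R" using l finR by (meson card_Diff1_less)
      show "R - {l} \<subseteq> verts G" using RV by auto
      show "c' ` verts G \<subseteq> R - {l}" using cR u by (auto simp: c'_def)
      show "{x, y} \<in> edges G \<Longrightarrow> c' x = c' y \<or> (c' x = x \<and> c' y = y)" for x y
        by (rule inv')
      show "3 * card {x \<in> verts G. c' x = r} < card (verts G)" if r: "r \<in> R - {l}" for r
      proof (cases "r = u")
        case True
        then show ?thesis using False by (simp add: A_def)
      next
        case neq: False
        then have "{x \<in> verts G. c' x = r} = {x \<in> verts G. c x = r}"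
          using r by (auto simp: c'_def)
        then show ?thesis using small r by simp
      qed
    qed
  qed
qed

text \<open>The contraction starts from the identity map, whose fibres are single vertices; four
  vertices make each of them smaller than a third. The leaves come from acyclicity, since a set in
  which every vertex had two neighbours would contain a cycle.\<close>

lemma forest_balanced_cut:
  assumes "simple_graph G" "4 \<le> card (verts G)" "\<And>c. \<not> is_cycle G c"
  shows "\<exists>A u. A \<subseteq> verts G \<and> u \<in> verts G \<and> card (verts G) \<le> 3 * card A \<and>
           3 * card A \<le> 2 * card (verts G) \<and> edge_boundary G A \<subseteq> {e \<in> edges G. u \<in> e}"
proof (rule forest_contraction_balanced_cut[where R = "verts G" and c = "\<lambda>x. x"])
  show "\<exists>v\<in>R. card {w \<in> R. {v, w} \<in> edges G} \<le> 1" if "R \<subseteq> verts G" "R \<noteq> {}" for R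
  proof (rule ccontr)
    assume "\<not> ?thesis"
    then have "2 \<le> card {w \<in> R. {v, w} \<in> edges G}" if "v \<in> R" for v
      using that by force
    then show False using min_degree_two_imp_cycle[OF assms(1) that] assms(3) by blast
  qed
  show "3 * card {x \<in> verts G. x = r} < card (verts G)" if "r \<in> verts G" for r
  proof -
    have "{x \<in> verts G. x = r} = {r}" using that by auto
    then show ?thesis using assms(2) by simp
  qed
qed (use assms in auto)

section \<open>Recursive partition by balanced cuts\<close>

definition crossing_edges :: "'a graph \<Rightarrow> 'a set \<Rightarrow> 'a set \<Rightarrow> 'a set set" where
  "crossing_edges G A B = {e \<in> edges G. e \<inter> A \<noteq> {} \<and> e \<inter> B \<noteq> {}}"

text \<open>Inclusion-exclusion: an edge in both boundaries crosses, and an edge in just one of them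
  either crosses or leaves the union. A crossing edge is thus paid for at most twice.\<close>

lemma card_edge_boundary_disjoint_Un:
  assumes G: "simple_graph G" and "A \<inter> B = {}"
  shows "card (edge_boundary G A) + card (edge_boundary G B)
    \<le> card (edge_boundary G (A \<union> B)) + 2 * card (crossing_edges G A B)"
proof -
  let ?b = "edge_boundary G" and ?C = "crossing_edges G A B"
  have fin: "finite (?b X)" "finite ?C" for X
    using finite_edges[OF G] by (auto simp: edge_boundary_def crossing_edges_def)
  have "?b A \<inter> ?b B \<subseteq> ?C"
    by (auto simp: edge_boundary_def crossing_edges_def)
  moreover have "?b A \<union> ?b B \<subseteq> ?b (A \<union> B) \<union> ?C"
    by (auto simp: edge_boundary_def crossing_edges_def Int_Un_distrib)
  ultimately have "card (?b A \<inter> ?b B) \<le> card ?C" "card (?b A \<union> ?b B) \<le> card (?b (A \<union> B) \<union> ?C)"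
    using fin by (auto intro!: card_mono)
  moreover have "card (?b (A \<union> B) \<union> ?C) \<le> card (?b (A \<union> B)) + card ?C" by (rule card_Un_le)
  ultimately show ?thesis
    using card_Un_Int[OF fin(1)[of A] fin(1)[of B]] by linarith
qed

text \<open>The term \<open>4 * K * s * log 2 (3 * s / m)\<close> is a potential. Both sides of a
  cut have at most two thirds of the \<open>s\<close> vertices, so each logarithm drops by at least
  1/2 and the total potential by at least \<open>2 * K * s\<close>, which pays for the crossing
  edges counted twice. A side of a balanced cut also keeps at least a third of more than
  \<open>m\<close> vertices; this gives the lower size bound, and the factor 3 in the logarithm
  keeps the potential nonnegative down to that size.\<close>

lemma partition_by_balanced_cuts:
  fixes m K :: real
  assumes G: "simple_graph G" and m: "0 < m" and K: "0 \<le> K"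
    and cut: "\<And>S. S \<subseteq> verts G \<Longrightarrow> m < real (card S) \<Longrightarrow>
      \<exists>A B. A \<union> B = S \<and> A \<inter> B = {} \<and> 3 * card A \<le> 2 * card S \<and> 3 * card B \<le> 2 * card S \<and>
        real (card (crossing_edges G A B)) \<le> K * real (card S)"
    and "S \<subseteq> verts G" "m / 3 \<le> real (card S)"
  shows "\<exists>P. finite P \<and> disjoint P \<and> \<Union>P = S \<and>
      (\<forall>A\<in>P. m / 3 \<le> real (card A) \<and> real (card A) \<le> m) \<and>
      (\<Sum>A\<in>P. real (card (edge_boundary G A)))
        \<le> real (card (edge_boundary G S)) + 4 * K * real (card S) * log 2 (3 * real (card S) / m)"
  using assms(5-)
proof (induction "card S" arbitrary: S rule: less_induct)
  case less
  let ?b = "\<lambda>A. real (card (edge_boundary G A))"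
  let ?f = "\<lambda>s::real. 4 * K * s * log 2 (3 * s / m)"
  define s where "s = real (card S)"
  show ?case
  proof (cases "real (card S) \<le> m")
    case True
    have "0 \<le> ?f (real (card S))"
      using less.prems m K by (intro mult_nonneg_nonneg) (auto simp: field_simps)
    then show ?thesis
      using True less.prems by (intro exI[of _ "{S}"]) auto
  next
    case False
    then have sm: "m < s" by (simp add: s_def)
    obtain A B where AB: "A \<union> B = S" "A \<inter> B = {}" "3 * card A \<le> 2 * card S"
      "3 * card B \<le> 2 * card S" "real (card (crossing_edges G A B)) \<le> K * real (card S)"
      using cut[OF less.prems(1)] False by force
    define a where "a = real (card A)"
    define b where "b = real (card B)"
    have finS: "finite S" using less.prems(1) G finite_subset by (auto simp: simple_graph_def)
    have "card S = card A + card B"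
      using AB finS card_Un_disjoint by (metis finite_Un)
    then have ab: "a + b = s" "3 * a \<le> 2 * s" "3 * b \<le> 2 * s"
      using AB(3,4) by (auto simp: a_def b_def s_def)
    have posS: "0 < card S" using sm m by (auto simp: s_def)
    have lt: "card A < card S" "card B < card S" using AB(3,4) posS by linarith+
    have sub: "A \<subseteq> verts G" "B \<subseteq> verts G" using AB less.prems by auto
    have lower: "m / 3 \<le> a" "m / 3 \<le> b" using ab sm by linarith+
    obtain P where P: "finite P" "disjoint P" "\<Union>P = A"
      "\<forall>X\<in>P. m / 3 \<le> real (card X) \<and> real (card X) \<le> m" "sum ?b P \<le> ?b A + ?f a"
      using less.hyps[OF lt(1) sub(1)] lower by (auto simp: a_def)
    obtain Q where Q: "finite Q" "disjoint Q" "\<Union>Q = B"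
      "\<forall>X\<in>Q. m / 3 \<le> real (card X) \<and> real (card X) \<le> m" "sum ?b Q \<le> ?b B + ?f b"
      using less.hyps[OF lt(2) sub(2)] lower by (auto simp: b_def)
    \<comment> \<open>Only the empty set could belong to both families, and the lower size bound
      excludes it. Without this the sum over the union would not split.\<close>
    have "P \<inter> Q = {}"
    proof -
      have "X = {}" if "X \<in> P" "X \<in> Q" for X using that P(3) Q(3) AB(2) by auto
      moreover have "{} \<notin> P" using P(4) m by fastforce
      ultimately show ?thesis by blast
    qed
    have half: "?f x \<le> 4 * K * x * (log 2 (3 * s / m) - 1 / 2)" if x: "m / 3 \<le> x" "3 * x \<le> 2 * s" for x
    proof -
      have "x > 0" using x m by linarith
      \<comment> \<open>This is 2 <= 9/4 after squaring.\<close>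
      have "1 / 2 \<le> log 2 (3 / 2 :: real)"
      proof -
        have "log 2 2 \<le> log 2 ((3 / 2 :: real)^2)" by (subst log_le_cancel_iff) (auto simp: power2_eq_square)
        then show ?thesis by (simp add: log_nat_power)
      qed
      moreover have "log 2 (3 * x / m) + log 2 (3 / 2) = log 2 (3 * x / m * (3 / 2))"
        using \<open>x > 0\<close> m by (subst log_mult) auto
      moreover have "\<dots> \<le> log 2 (3 * s / m)"
        using \<open>x > 0\<close> m x by (subst log_le_cancel_iff) (auto simp: field_simps)
      ultimately have "log 2 (3 * x / m) \<le> log 2 (3 * s / m) - 1 / 2" by linarith
      then show ?thesis using \<open>x > 0\<close> K by (intro mult_left_mono) auto
    qed
    have "sum ?b (P \<union> Q) = sum ?b P + sum ?b Q"
      using P Q \<open>P \<inter> Q = {}\<close> by (intro sum.union_disjoint) auto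
    also have "\<dots> \<le> ?b A + ?b B + 4 * K * a * (log 2 (3 * s / m) - 1 / 2)
        + 4 * K * b * (log 2 (3 * s / m) - 1 / 2)"
      using P(5) Q(5) half[of a] half[of b] lower ab by linarith
    also have "\<dots> = ?b A + ?b B + 4 * K * (a + b) * (log 2 (3 * s / m) - 1 / 2)"
      by (simp add: algebra_simps)
    also have "\<dots> = ?b A + ?b B + ?f s - 2 * K * s"
      unfolding ab by (simp add: algebra_simps)
    also have "\<dots> \<le> ?b S + ?f s"
      using card_edge_boundary_disjoint_Un[OF G AB(2)] AB(1,5) by (simp add: s_def)
    finally have "sum ?b (P \<union> Q) \<le> ?b S + ?f s" .
    moreover have "disjoint (P \<union> Q)"
      using P Q AB(2) by (intro disjoint_union) auto
    ultimately show ?thesis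
      using P Q AB(1) by (intro exI[of _ "P \<union> Q"]) (auto simp: s_def)
  qed
qed

section \<open>Induced subgraphs, separators and degrees\<close>

definition induced :: "'a graph \<Rightarrow> 'a set \<Rightarrow> 'a graph" where
  "induced G S = \<lparr>verts = S, edges = {e \<in> edges G. e \<subseteq> S}\<rparr>"

lemma induced_simps [simp]:
  "verts (induced G S) = S" "edges (induced G S) = {e \<in> edges G. e \<subseteq> S}"
  by (auto simp: induced_def)

lemma subgraph_induced:
  assumes "subgraph H G" "S \<subseteq> verts H"
  shows "subgraph (induced H S) G"
  using assms finite_subset[of S] by (auto simp: subgraph_def simple_graph_def)

lemma is_cycle_subgraph:
  assumes "subgraph H G" "is_cycle H c"
  shows "is_cycle G c"
  using assms by (auto simp: subgraph_def is_cycle_def)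

text \<open>\<open>Min\<close> yields a member only for a nonempty finite set. Nonemptiness comes
  from splitting the vertices into two halves and removing all edges; with at least two vertices the
  larger half has at most two thirds of them.\<close>

lemma sep_E_attained:
  assumes G: "simple_graph G" and two: "2 \<le> card (verts G)"
  shows "\<exists>F. edge_separator G F \<and> card F = sep_E G"
proof -
  obtain A where A: "A \<subseteq> verts G" "card A = card (verts G) div 2"
    using obtain_subset_with_card_n[of "card (verts G) div 2" "verts G"] by auto
  have finV: "finite (verts G)" using G by (simp add: simple_graph_def)
  have "card (verts G - A) = card (verts G) - card (verts G) div 2"
    using A finV by (simp add: card_Diff_subset finite_subset)
  then have "3 * card A \<le> 2 * card (verts G)" "3 * card (verts G - A) \<le> 2 * card (verts G)"
    using A two by linarith+
  then have "real (card A) \<le> 2 / 3 * real (card (verts G))"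
    "real (card (verts G - A)) \<le> 2 / 3 * real (card (verts G))"
    by linarith+
  then have "edge_separator G (edges G)"
    unfolding edge_separator_def using A by (intro conjI exI[of _ A] exI[of _ "verts G - A"]) auto
  moreover have "finite {card F | F. edge_separator G F}"
  proof (rule finite_subset)
    show "{card F | F. edge_separator G F} \<subseteq> card ` Pow (edges G)"
      by (auto simp: edge_separator_def)
  qed (use finite_edges[OF G] in simp)
  ultimately have "sep_E G \<in> {card F | F. edge_separator G F}"
    unfolding sep_E_def by (intro Min_in) auto
  then show ?thesis by force
qed

lemma vertex_degree_subgraph_le:
  assumes "subgraph H G" "simple_graph G"
  shows "vertex_degree H v \<le> vertex_degree G v"
  unfolding vertex_degree_def using assms finite_edges[of G]
  by (intro card_mono) (auto simp: subgraph_def)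

lemma vertex_degree_le_max_degree:
  assumes "simple_graph G" "v \<in> verts G"
  shows "vertex_degree G v \<le> max_degree G"
  unfolding max_degree_def using assms by (intro Max_ge) (auto simp: simple_graph_def)

lemma edge_expansion_le_degree:
  fixes d :: real
  assumes H: "simple_graph H" and A: "A \<subseteq> verts H" "A \<noteq> {}"
    and deg: "\<And>v. v \<in> A \<Longrightarrow> real (vertex_degree H v) \<le> d"
  shows "edge_expansion H A \<le> d"
proof -
  have finA: "finite A" using H A finite_subset by (auto simp: simple_graph_def)
  have "edge_boundary H A \<subseteq> (\<Union>v\<in>A. {e \<in> edges H. v \<in> e})"
  proof
    fix e assume e: "e \<in> edge_boundary H A"
    then have "e \<inter> A \<noteq> {}" by (auto simp: edge_boundary_def)
    with e show "e \<in> (\<Union>v\<in>A. {e \<in> edges H. v \<in> e})" by (auto simp: edge_boundary_def)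
  qed
  then have "card (edge_boundary H A) \<le> card (\<Union>v\<in>A. {e \<in> edges H. v \<in> e})"
    using finA finite_edges[OF H] by (intro card_mono) auto
  also have "\<dots> \<le> (\<Sum>v\<in>A. vertex_degree H v)"
    unfolding vertex_degree_def by (rule card_UN_le[OF finA])
  finally have "real (card (edge_boundary H A)) \<le> (\<Sum>v\<in>A. real (vertex_degree H v))"
    by (metis of_nat_le_iff of_nat_sum)
  also have "\<dots> \<le> real (card A) * d"
    using sum_bounded_above[of A "\<lambda>v. real (vertex_degree H v)" d] deg by simp
  finally show ?thesis
    using A finA by (simp add: edge_expansion_def field_simps card_gt_0_iff)
qed

section \<open>Estimates for iterated logarithms\<close>

lemma two_powr_ge_half:
  fixes u :: real assumes "0 \<le> u" shows "u / 2 \<le> 2 powr u"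
proof -
  \<comment> \<open>From e <= 3 < 4 follows \<open>ln 2 \<ge> 1 / 2\<close>.\<close>
  have "ln (exp 1) \<le> ln ((2::real) ^ 2)" using exp_le by (subst ln_le_cancel_iff) auto
  then have "1 / 2 \<le> ln (2::real)" by (simp only: ln_exp ln_realpow)
  then have "u * (1 / 2) \<le> u * ln 2" using assms by (intro mult_left_mono)
  also have "\<dots> \<le> exp (u * ln 2)" using exp_ge_add_one_self[of "u * ln 2"] by linarith
  finally show ?thesis by (simp add: powr_def)
qed

text \<open>The square of the linear bound at \<open>u / 2\<close>.\<close>

lemma two_powr_ge_square:
  fixes u :: real assumes "0 \<le> u" shows "u\<^sup>2 / 16 \<le> 2 powr u"
proof -
  have "(u / 4)\<^sup>2 \<le> (2 powr (u / 2))\<^sup>2"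
    using two_powr_ge_half[of "u / 2"] assms by (intro power_mono) auto
  also have "\<dots> = 2 powr u" by (simp add: power2_eq_square powr_add[symmetric])
  finally show ?thesis by (simp add: power_divide)
qed

text \<open>Dividing \<open>log n\<close> by \<open>(6 * k)\<^sup>2\<close> costs at most a square
  root, because \<open>6 * k\<close> is at most the triple logarithm \<open>z\<close> of
  \<open>n\<close>. Hence \<open>t\<close> is at least the square root of \<open>log n\<close>, its
  logarithm at least half of \<open>y\<close>, and its double logarithm at least
  \<open>z - 1\<close>, which exceeds \<open>6 * k\<close> by a wide margin.\<close>

lemma log_log_lower_bound:
  fixes n t :: nat and k :: real
  assumes n: "0 < n" and k: "2 \<le> k" "k \<le> 1 / 648 * log 2 (log 2 (log 2 (real n)))"
    and t: "log 2 (real n) / (6 * k)\<^sup>2 \<le> real t"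
  shows "6 * k \<le> log 2 (log 2 (real t))" "64 \<le> log 2 (real t)" "log 2 (real t) \<le> sqrt (real t)"
proof -
  define x where "x = log 2 (real n)"
  define y where "y = log 2 x"
  define z where "z = log 2 y"
  have z: "648 * k \<le> z" using k by (simp add: x_def y_def z_def)
  have z1: "1296 \<le> z" using z k by linarith
  \<comment> \<open>Since \<open>ln 0 = 0\<close>, the case \<open>n = 1\<close> would make
    \<open>x\<close>, \<open>y\<close> and \<open>z\<close> all zero. The same convention gives
    \<open>y \<noteq> 0\<close> below.\<close>
  have "n \<noteq> 1" using z1 by (auto simp: x_def y_def z_def log_def)
  then have "2 \<le> real n" using n by linarith
  then have "1 \<le> x" by (simp add: x_def)
  then have "0 \<le> y" by (simp add: y_def)
  moreover have "y \<noteq> 0" using z1 by (auto simp: z_def log_def)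
  ultimately have "0 < y" by simp
  have xy: "x = 2 powr y" using \<open>1 \<le> x\<close> by (simp add: y_def)
  have yz: "y = 2 powr z" using \<open>0 < y\<close> by (simp add: z_def)
  \<comment> \<open>From \<open>1296 * z \<le> z * z \<le> 16 * y\<close> follows
    \<open>z \<le> y / 81\<close>, below the bound \<open>y / 8\<close> on the right-hand
    side.\<close>
  have "z \<le> 2 powr (y / 4)"
  proof -
    have "1296 * z \<le> z * z" using z1 by (intro mult_right_mono) auto
    moreover have "z * z / 16 \<le> y" using two_powr_ge_square[of z] z1 by (simp add: yz power2_eq_square)
    moreover have "y / 4 / 2 \<le> 2 powr (y / 4)" using two_powr_ge_half[of "y / 4"] \<open>0 < y\<close> by simp
    ultimately show ?thesis using z1 by linarith
  qed
  then have "z * z \<le> 2 powr (y / 4) * 2 powr (y / 4)"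
    using z1 by (intro mult_mono) auto
  also have "\<dots> = 2 powr (y / 2)" by (simp add: powr_add[symmetric])
  finally have zz: "z * z \<le> 2 powr (y / 2)" .
  have "(6 * k)\<^sup>2 \<le> z\<^sup>2" using z k by (intro power_mono) auto
  then have "(6 * k)\<^sup>2 \<le> 2 powr (y / 2)" using zz by (simp add: power2_eq_square)
  then have "2 powr (y / 2) * (6 * k)\<^sup>2 \<le> 2 powr (y / 2) * 2 powr (y / 2)"
    by (intro mult_left_mono) auto
  also have "\<dots> = x" by (simp add: xy powr_add[symmetric])
  finally have "2 powr (y / 2) \<le> x / (6 * k)\<^sup>2" using k by (simp add: field_simps)
  then have ty: "2 powr (y / 2) \<le> real t" using t by (simp add: x_def)
  then have "0 < real t" using powr_gt_zero[of 2 "y / 2"] by linarith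
  define w where "w = log 2 (real t)"
  have tw: "real t = 2 powr w" using \<open>0 < real t\<close> by (simp add: w_def)
  have wy: "y / 2 \<le> w" using ty by (simp add: tw)
  have "2 powr (z - 1) = y / 2" by (simp add: powr_diff yz)
  then have "z - 1 = log 2 (y / 2)"
    using log_powr_cancel[of 2 "z - 1"] by (simp only:)
  also have "\<dots> \<le> log 2 w" using wy \<open>0 < y\<close> by simp
  finally have "z - 1 \<le> log 2 w" .
  then show "6 * k \<le> log 2 (log 2 (real t))" using z z1 by (simp add: w_def)
  have "z * z / 16 \<le> y" using two_powr_ge_square[of z] z1 by (simp add: yz power2_eq_square)
  moreover have "1296 * 1296 \<le> z * z" using z1 by (intro mult_mono) auto
  ultimately have w64: "64 \<le> w" using wy by linarith
  then show "64 \<le> log 2 (real t)" by (simp add: w_def)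
  \<comment> \<open>The quadratic bound at \<open>w / 2\<close> has denominator 64, so
    \<open>w \<ge> 64\<close> is just what makes it dominate \<open>w\<close>.\<close>
  have "64 * w \<le> w * w" using w64 by (intro mult_right_mono) auto
  moreover have "w * w / 64 \<le> 2 powr (w / 2)"
    using two_powr_ge_square[of "w / 2"] w64 by (simp add: power_divide power2_eq_square)
  ultimately have "w \<le> 2 powr (w / 2)" by linarith
  also have "\<dots> = sqrt (real t)"
    by (simp add: tw powr_half_sqrt[symmetric] powr_powr)
  finally show "log 2 (real t) \<le> sqrt (real t)" by (simp add: w_def)
qed

section \<open>Selecting disjoint sets of prescribed size or small expansion\<close>

lemma disjoint_subsets_of_card:
  fixes q N :: nat
  assumes "finite V" "N * q \<le> card V"
  shows "\<exists>A. disjoint_family_on A {..<N} \<and> (\<forall>i<N. A i \<subseteq> V \<and> card (A i) = q)"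
  using assms(2)
proof (induction N)
  case 0
  then show ?case by (auto simp: disjoint_family_on_def)
next
  case (Suc N)
  then obtain A where A: "disjoint_family_on A {..<N}" "\<forall>i<N. A i \<subseteq> V \<and> card (A i) = q" by auto
  have "card (\<Union>i<N. A i) \<le> (\<Sum>i<N. card (A i))" by (rule card_UN_le) simp
  also have "\<dots> = N * q" using A by simp
  finally have "q \<le> card (V - (\<Union>i<N. A i))"
    using Suc.prems diff_card_le_card_Diff[of "\<Union>i<N. A i" V] A assms(1)
    by (fastforce intro: finite_subset[OF _ assms(1)])
  then obtain B where B: "B \<subseteq> V - (\<Union>i<N. A i)" "card B = q"
    using obtain_subset_with_card_n by metis
  have "disjoint_family_on (A(N := B)) {..<Suc N}"
    using A(1) B(1) by (fastforce simp: disjoint_family_on_def less_Suc_eq)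
  moreover have "\<forall>i<Suc N. (A(N := B)) i \<subseteq> V \<and> card ((A(N := B)) i) = q"
    using A B by (auto simp: less_Suc_eq)
  ultimately show ?case by blast
qed

text \<open>Use sets of \<open>q = nat \<lfloor>\<mu> * t\<rfloor>\<close> elements. As
  \<open>\<mu> * t \<ge> 1\<close>, rounding down loses less than half. Rounding up the number of
  sets costs at most one more, and \<open>t * (1 / 4 + \<mu>) \<le> t\<close> shows that they
  fit.\<close>

lemma disjoint_subsets_in_size_range:
  fixes \<mu> :: real
  assumes V: "finite V" and \<mu>: "1 / real (card V) \<le> \<mu>" "\<mu> \<le> 2 / 3" "V \<noteq> {}"
  shows "\<exists>A. disjoint_family_on A {..<nat \<lceil>1 / (4 * \<mu>)\<rceil>} \<and>
    (\<forall>i<nat \<lceil>1 / (4 * \<mu>)\<rceil>. A i \<subseteq> V \<and> A i \<noteq> {} \<and>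
      \<mu> * real (card V) / 3 \<le> real (card (A i)) \<and> real (card (A i)) \<le> \<mu> * real (card V))"
proof -
  define t where "t = real (card V)"
  have "0 < card V" using V \<mu> by (simp add: card_gt_0_iff)
  then have "0 < t" by (simp add: t_def)
  have "1 / t \<le> \<mu>" using \<mu> by (simp add: t_def)
  moreover have "0 < 1 / t" using \<open>0 < t\<close> by simp
  ultimately have "0 < \<mu>" by linarith
  have one: "1 \<le> \<mu> * t" using \<open>1 / t \<le> \<mu>\<close> \<open>0 < t\<close> by (simp add: field_simps)
  define q where "q = nat \<lfloor>\<mu> * t\<rfloor>"
  have q: "real q \<le> \<mu> * t" "\<mu> * t < real q + 1" "1 \<le> real q"
    using one by (auto simp: q_def)
  define N where "N = nat \<lceil>1 / (4 * \<mu>)\<rceil>"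
  have "real N \<le> 1 / (4 * \<mu>) + 1"
    using \<open>0 < \<mu>\<close> by (simp add: N_def)
  then have "real N * real q \<le> (1 / (4 * \<mu>) + 1) * (\<mu> * t)"
    using q by (intro mult_mono) auto
  also have "\<dots> = t * (1 / 4 + \<mu>)" using \<open>0 < \<mu>\<close> by (simp add: field_simps)
  also have "\<dots> \<le> t * 1" using \<mu> \<open>0 < t\<close> by (intro mult_left_mono) auto
  finally have "real (N * q) \<le> real (card V)" by (simp add: t_def)
  then have "N * q \<le> card V" by linarith
  then obtain A where A: "disjoint_family_on A {..<N}" "\<forall>i<N. A i \<subseteq> V \<and> card (A i) = q"
    using disjoint_subsets_of_card[OF V] by blast
  have "q \<noteq> 0" using q by auto
  have "\<mu> * t / 3 \<le> real q" using q by linarith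
  then show ?thesis
    using A q \<open>q \<noteq> 0\<close> unfolding N_def t_def by (intro exI[of _ A]) force
qed

text \<open>Parts of size at most \<open>\<mu> * t\<close> that cover everything number at least
  \<open>1 / \<mu>\<close>. Each bad part has boundary at least
  \<open>196 * L * \<mu> * t / 3\<close>, so the total \<open>32 * t * L\<close> allows at most
  \<open>96 / (196 * \<mu>)\<close> of them, less than half of \<open>1 / \<mu>\<close>. More than
  the required quarter remain good.\<close>

lemma many_parts_of_small_expansion:
  fixes \<mu> L :: real
  assumes H: "simple_graph H" and P: "finite P" "disjoint P" "\<Union>P = verts H"
    and size: "\<forall>A\<in>P. \<mu> * real (card (verts H)) / 3 \<le> real (card A) \<and>
      real (card A) \<le> \<mu> * real (card (verts H))"
    and bd: "(\<Sum>A\<in>P. real (card (edge_boundary H A))) \<le> 32 * real (card (verts H)) * L"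
    and pos: "0 < \<mu>" "0 < L" "verts H \<noteq> {}"
  shows "\<exists>A. disjoint_family_on A {..<nat \<lceil>1 / (4 * \<mu>)\<rceil>} \<and>
    (\<forall>i<nat \<lceil>1 / (4 * \<mu>)\<rceil>. A i \<in> P \<and> edge_expansion H (A i) \<le> 196 * L)"
proof -
  define t where "t = real (card (verts H))"
  have finV: "finite (verts H)" using H by (simp add: simple_graph_def)
  have "0 < t" using pos finV by (simp add: t_def card_gt_0_iff)
  define good where "good = {A \<in> P. edge_expansion H A \<le> 196 * L}"
  have "card (verts H) \<le> (\<Sum>A\<in>P. card A)"
    unfolding P(3)[symmetric] by (rule card_Union_le_sum_card)
  then have "t \<le> (\<Sum>A\<in>P. real (card A))"
    unfolding t_def by (metis of_nat_le_iff of_nat_sum)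
  also have "\<dots> \<le> real (card P) * (\<mu> * t)"
    using size by (intro sum_bounded_above) (auto simp: t_def)
  finally have "1 * t \<le> (real (card P) * \<mu>) * t" by simp
  then have cP: "1 \<le> real (card P) * \<mu>" using \<open>0 < t\<close> by (simp only: mult_le_cancel_right_pos)
  have "196 * L * (\<mu> * t / 3) \<le> real (card (edge_boundary H A))" if A: "A \<in> P - good" for A
  proof -
    have "196 * L < edge_expansion H A" using A by (auto simp: good_def)
    moreover have "\<mu> * t / 3 \<le> real (card A)" "0 < \<mu> * t / 3"
      using size A \<open>0 < t\<close> pos by (auto simp: t_def)
    ultimately have "196 * L * real (card A) \<le> real (card (edge_boundary H A))"
      by (simp add: edge_expansion_def field_simps)
    moreover have "196 * L * (\<mu> * t / 3) \<le> 196 * L * real (card A)"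
      using \<open>\<mu> * t / 3 \<le> real (card A)\<close> pos by (intro mult_left_mono) auto
    ultimately show ?thesis by linarith
  qed
  then have "real (card (P - good)) * (196 * L * (\<mu> * t / 3))
      \<le> (\<Sum>A\<in>P - good. real (card (edge_boundary H A)))"
    by (intro sum_bounded_below) auto
  also have "\<dots> \<le> (\<Sum>A\<in>P. real (card (edge_boundary H A)))"
    using P by (intro sum_mono2) auto
  also have "\<dots> \<le> 32 * t * L" using bd by (simp add: t_def)
  finally have "(real (card (P - good)) * \<mu> * 196 / 3) * (t * L) \<le> 32 * (t * L)"
    by (simp add: algebra_simps)
  then have bad: "real (card (P - good)) * \<mu> * 196 / 3 \<le> 32"
    using \<open>0 < t\<close> \<open>0 < L\<close> by (simp only: mult_le_cancel_right_pos mult_pos_pos)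
  have "card P = card good + card (P - good)"
    using P card_Diff_subset[of good P] card_mono[of P good] by (auto simp: good_def)
  then have "real (card P) * \<mu> = real (card good) * \<mu> + real (card (P - good)) * \<mu>"
    by (simp add: algebra_simps)
  then have "1 / 4 \<le> real (card good) * \<mu>" using cP bad by linarith
  then have "1 / (4 * \<mu>) \<le> real (card good)" using pos by (simp add: field_simps)
  then have N: "nat \<lceil>1 / (4 * \<mu>)\<rceil> \<le> card good" by (simp add: nat_le_iff ceiling_le_iff)
  have "finite good" using P by (simp add: good_def)
  then obtain f where f: "bij_betw f {0..<card good} good" using ex_bij_betw_nat_finite by blast
  have fg: "f i \<in> good" if "i < nat \<lceil>1 / (4 * \<mu>)\<rceil>" for i
  proof -
    have "i \<in> {0..<card good}" using less_le_trans[OF that N] by simp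
    then show ?thesis using bij_betwE[OF f] by blast
  qed
  have "disjoint_family_on f {..<nat \<lceil>1 / (4 * \<mu>)\<rceil>}"
    unfolding disjoint_family_on_def
  proof (intro ballI impI)
    fix i j assume ij: "i \<in> {..<nat \<lceil>1 / (4 * \<mu>)\<rceil>}" "j \<in> {..<nat \<lceil>1 / (4 * \<mu>)\<rceil>}" "i \<noteq> j"
    then have "i < card good" "j < card good" using less_le_trans[OF _ N] by auto
    then have "f i \<noteq> f j" using f ij(3) by (auto simp: bij_betw_def inj_on_def)
    then show "f i \<inter> f j = {}"
      using fg ij P(2) by (auto simp: good_def pairwise_def disjnt_def)
  qed
  then show ?thesis using fg by (intro exI[of _ f]) (auto simp: good_def)
qed

section \<open>Combination of the degree bound and the recursive partition\<close>

theorem theorem2: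
  fixes n :: nat and k :: real and G :: "'a graph"
  assumes "0 < n"
    and "2 \<le> k" and "k \<le> 1 / 648 * log 2 (log 2 (log 2 (real n)))"
    and "simple_graph G" and "card (verts G) = n"
    and "k \<le> average_degree G" and "real (max_degree G) \<le> 6 * k"
    and "ereal (log 2 (real n) / (6 * k)\<^sup>2) \<le> ereal_of_enat (girth G)"
    and "\<And>H t. subgraph H G \<Longrightarrow> card (verts H) = t \<Longrightarrow> log 2 (real n) / (6 * k)\<^sup>2 \<le> real t \<Longrightarrow>
           sep_V H \<le> sep_E H \<and>
           real (sep_E H) \<le> real t / log 2 (real t) * (log 2 (log 2 (real t)))\<^sup>2"
  shows "\<forall>(H :: 'a graph) (t :: nat) (\<mu> :: real).
           subgraph H G \<longrightarrow> card (verts H) = t \<longrightarrow> log 2 (real n) / (6 * k)\<^sup>2 \<le> real t \<longrightarrow>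
           1 / real t \<le> \<mu> \<longrightarrow> \<mu> \<le> 2 / 3 \<longrightarrow>
           (\<exists>A :: nat \<Rightarrow> 'a set.
              disjoint_family_on A {..<nat \<lceil>1 / (4 * \<mu>)\<rceil>} \<and>
              (\<forall>i<nat \<lceil>1 / (4 * \<mu>)\<rceil>.
                 A i \<subseteq> verts H \<and>
                 \<mu> * real t / 3 \<le> real (card (A i)) \<and> real (card (A i)) \<le> \<mu> * real t \<and>
                 edge_expansion H (A i)
                   \<le> log 2 (1 / \<mu>) / log 2 (real t) * (14 * log 2 (log 2 (real t)))\<^sup>2))"
proof (intro allI impI)
  fix H :: "'a graph" and t :: nat and \<mu> :: real
  assume HG: "subgraph H G" and Ht: "card (verts H) = t"
    and tT: "log 2 (real n) / (6 * k)\<^sup>2 \<le> real t" and \<mu>: "1 / real t \<le> \<mu>" "\<mu> \<le> 2 / 3"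
  define w where "w = log 2 (real t)"
  define l where "l = log 2 w"
  note num = log_log_lower_bound[OF assms(1-3) tT]
  have kl: "6 * k \<le> l" and w64: "64 \<le> w" and wt: "w \<le> sqrt (real t)"
    using num by (auto simp: w_def l_def)
  have l12: "12 \<le> l" using kl assms(2) by linarith
  have t0: "0 < real t" using w64 by (cases "t = 0") (auto simp: w_def log_def)
  have \<mu>0: "0 < \<mu>"
  proof -
    have "0 < 1 / real t" using t0 by simp
    then show ?thesis using \<mu> by linarith
  qed
  have lmu: "0 < log 2 (1 / \<mu>)" using \<mu> \<mu>0 by simp
  define L where "L = log 2 (1 / \<mu>) * l\<^sup>2 / w"
  have L0: "0 < L" using lmu l12 w64 by (simp add: L_def)
  \<comment> \<open>The constant is 14 squared; \<open>L\<close> collects the remaining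
    factors.\<close>
  have goal_eq: "log 2 (1 / \<mu>) / log 2 (real t) * (14 * log 2 (log 2 (real t)))\<^sup>2 = 196 * L"
    by (simp add: L_def w_def l_def power_mult_distrib)
  have Hs: "simple_graph H" using HG by (simp add: subgraph_def)
  have finV: "finite (verts H)" using Hs by (simp add: simple_graph_def)
  have Vne: "verts H \<noteq> {}" using Ht t0 by auto
  have degG: "real (vertex_degree G v) \<le> l" if "v \<in> verts G" for v
    using vertex_degree_le_max_degree[OF assms(4) that] assms(7) kl by linarith
  have deg: "real (vertex_degree H v) \<le> l" if "v \<in> verts H" for v
    using degG[of v] vertex_degree_subgraph_le[OF HG assms(4), of v] HG that
    by (auto simp: subgraph_def)
  show "\<exists>A :: nat \<Rightarrow> 'a set.
              disjoint_family_on A {..<nat \<lceil>1 / (4 * \<mu>)\<rceil>} \<and>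
              (\<forall>i<nat \<lceil>1 / (4 * \<mu>)\<rceil>.
                 A i \<subseteq> verts H \<and>
                 \<mu> * real t / 3 \<le> real (card (A i)) \<and> real (card (A i)) \<le> \<mu> * real t \<and>
                 edge_expansion H (A i)
                   \<le> log 2 (1 / \<mu>) / log 2 (real t) * (14 * log 2 (log 2 (real t)))\<^sup>2)"
    unfolding goal_eq
  proof (cases "\<mu> * real t \<le> sqrt (real t)")
    case True
    \<comment> \<open>Here \<open>1 / \<mu>\<close> is at least the square root of \<open>t\<close>,
      so \<open>L \<ge> l\<^sup>2 / 2\<close>, and \<open>l \<ge> 12\<close> makes this larger than
      needed.\<close>
    have "l \<le> 196 * L"
    proof -
      have "sqrt (real t) * sqrt (real t) = real t" by simp
      then have "\<mu> * sqrt (real t) * sqrt (real t) \<le> 1 * sqrt (real t)"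
        using True by (simp only: mult.assoc mult_1_left)
      then have "\<mu> * sqrt (real t) \<le> 1"
        by (rule mult_right_le_imp_le) (use t0 in simp)
      then have "sqrt (real t) \<le> 1 / \<mu>" using \<mu>0 by (simp add: field_simps)
      then have "log 2 (sqrt (real t)) \<le> log 2 (1 / \<mu>)"
        using t0 \<mu>0 by (subst log_le_cancel_iff) auto
      moreover have "log 2 (sqrt (real t)) = w / 2"
        using t0 by (simp add: w_def powr_half_sqrt[symmetric] log_powr)
      ultimately have "1 / 2 \<le> log 2 (1 / \<mu>) / w" using w64 by (simp add: field_simps)
      then have "1 / 2 * l\<^sup>2 \<le> log 2 (1 / \<mu>) / w * l\<^sup>2" by (intro mult_right_mono) auto
      moreover have "1 * l \<le> l * l" using l12 by (intro mult_right_mono) auto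
      ultimately show ?thesis using L0 by (simp add: L_def power2_eq_square)
    qed
    obtain A where A: "disjoint_family_on A {..<nat \<lceil>1 / (4 * \<mu>)\<rceil>}"
      "\<forall>i<nat \<lceil>1 / (4 * \<mu>)\<rceil>. A i \<subseteq> verts H \<and> A i \<noteq> {} \<and>
        \<mu> * real t / 3 \<le> real (card (A i)) \<and> real (card (A i)) \<le> \<mu> * real t"
      using disjoint_subsets_in_size_range[OF finV, unfolded Ht, OF \<mu> Vne]
      by (elim exE conjE) (rule that)
    have "edge_expansion H X \<le> 196 * L" if "X \<subseteq> verts H" "X \<noteq> {}" for X
      using edge_expansion_le_degree[OF Hs that deg] \<open>l \<le> 196 * L\<close> that(1) by (meson order_trans subsetD)
    then show "\<exists>A :: nat \<Rightarrow> 'a set.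
              disjoint_family_on A {..<nat \<lceil>1 / (4 * \<mu>)\<rceil>} \<and>
              (\<forall>i<nat \<lceil>1 / (4 * \<mu>)\<rceil>.
                 A i \<subseteq> verts H \<and>
                 \<mu> * real t / 3 \<le> real (card (A i)) \<and> real (card (A i)) \<le> \<mu> * real t \<and>
                 edge_expansion H (A i) \<le> 196 * L)"
      using A by (intro exI[of _ A] conjI allI impI) simp_all
  next
    case False
    define K where "K = 2 * l\<^sup>2 / w"
    have K0: "0 \<le> K" using w64 by (simp add: K_def)
    have cut: "\<exists>A B. A \<union> B = S \<and> A \<inter> B = {} \<and> 3 * card A \<le> 2 * card S \<and> 3 * card B \<le> 2 * card S \<and>
        real (card (crossing_edges H A B)) \<le> K * real (card S)"
      if S: "S \<subseteq> verts H" "\<mu> * real t < real (card S)" for S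
    proof -
      define s where "s = real (card S)"
      define I where "I = induced H S"
      have IG: "subgraph I G" using subgraph_induced[OF HG S(1)] by (simp add: I_def)
      then have Is: "simple_graph I" by (simp add: subgraph_def)
      have finS: "finite S" using S finV finite_subset by blast
      have st: "sqrt (real t) < s" "s \<le> real t"
        using S False finV Ht card_mono[of "verts H" S] by (auto simp: s_def)
      have s64: "64 < s" using st wt w64 by linarith
      show ?thesis
      proof (cases "log 2 (real n) / (6 * k)\<^sup>2 \<le> s")
        case True
        have "2 \<le> card (verts I)" using s64 by (simp add: I_def s_def)
        then obtain F where F: "edge_separator I F" "card F = sep_E I"
          using sep_E_attained[OF Is] by blast
        obtain A B where AB: "A \<union> B = S" "A \<inter> B = {}" "real (card A) \<le> 2 / 3 * s"
          "real (card B) \<le> 2 / 3 * s" "\<forall>a\<in>A. \<forall>b\<in>B. {a, b} \<notin> edges I - F"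
          using F(1) unfolding edge_separator_def by (auto simp: I_def s_def)
        \<comment> \<open>A crossing edge has both ends in \<open>S\<close>, so it is an edge of
          \<open>I\<close>, and the separator property applies to it.\<close>
        have "crossing_edges H A B \<subseteq> F"
        proof
          fix e assume e: "e \<in> crossing_edges H A B"
          then obtain a b where "a \<in> A" "a \<in> e" "b \<in> B" "b \<in> e" "e \<in> edges H"
            by (auto simp: crossing_edges_def)
          moreover from this obtain x y where "e = {x, y}"
            using simple_graph_edgeE[OF Hs] by metis
          ultimately have "e = {a, b}" using AB(2) by auto
          then show "e \<in> F"
            using AB \<open>a \<in> A\<close> \<open>b \<in> B\<close> \<open>e \<in> edges H\<close> by (auto simp: I_def)
        qed
        moreover have "finite F"
          using F(1) finite_edges[OF Is] finite_subset by (auto simp: edge_separator_def)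
        ultimately have "card (crossing_edges H A B) \<le> sep_E I"
          using F(2) card_mono by metis
        moreover have "real (sep_E I) \<le> s / log 2 s * (log 2 (log 2 s))\<^sup>2"
          using assms(9)[OF IG, of "card S"] True by (auto simp: I_def s_def)
        \<comment> \<open>The factor 2 in \<open>K\<close> is spent here: \<open>s\<close> exceeds
          the square root of \<open>t\<close>, so \<open>log 2 s \<ge> w / 2\<close>, while
          \<open>log 2 (log 2 s) \<le> l\<close> by monotonicity.\<close>
        moreover have "s / log 2 s * (log 2 (log 2 s))\<^sup>2 \<le> K * s"
        proof -
          have "log 2 (sqrt (real t)) \<le> log 2 s"
            using t0 s64 st by (subst log_le_cancel_iff) auto
          moreover have "log 2 (sqrt (real t)) = w / 2"
            using t0 by (simp add: w_def powr_half_sqrt[symmetric] log_powr)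
          ultimately have ls: "w / 2 \<le> log 2 s" by simp
          have lsw: "log 2 s \<le> w" unfolding w_def using st s64 by (subst log_le_cancel_iff) auto
          have "log 2 (log 2 s) \<le> l"
            unfolding l_def using lsw ls w64 by (subst log_le_cancel_iff) auto
          moreover have "0 \<le> log 2 (log 2 s)" using ls w64 by simp
          ultimately have "(log 2 (log 2 s))\<^sup>2 \<le> l\<^sup>2" by (intro power_mono)
          moreover have "s / log 2 s \<le> s / (w / 2)" using ls w64 s64 by (intro divide_left_mono) auto
          ultimately have "s / log 2 s * (log 2 (log 2 s))\<^sup>2 \<le> s / (w / 2) * l\<^sup>2"
            using s64 w64 by (intro mult_mono) auto
          then show ?thesis by (simp add: K_def mult.commute mult.left_commute)
        qed
        ultimately have "real (card (crossing_edges H A B)) \<le> K * real (card S)"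
          unfolding s_def by linarith
        moreover have "3 * card A \<le> 2 * card S" "3 * card B \<le> 2 * card S"
          using AB(3,4) unfolding s_def by linarith+
        ultimately show ?thesis using AB by blast
      next
        case small: False
        \<comment> \<open>A cycle in \<open>I\<close> has at most \<open>s\<close> vertices, fewer
          than the girth of \<open>G\<close> permits.\<close>
        have "\<not> is_cycle I c" for c
        proof
          assume c: "is_cycle I c"
          then have "is_cycle G c" using is_cycle_subgraph[OF IG] by blast
          then have "girth G \<le> enat (length c)"
            unfolding girth_def by (intro Inf_lower) auto
          then have "ereal_of_enat (girth G) \<le> ereal (real (length c))"
            using ereal_of_enat_le_iff by (metis ereal_of_enat_simps(1))
          then have "log 2 (real n) / (6 * k)\<^sup>2 \<le> real (length c)"
            using assms(8) by (metis ereal_less_eq(3) order_trans)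
          moreover have "length c \<le> card S"
            using c finS card_mono[of S "set c"] distinct_card[of c]
            by (auto simp: is_cycle_def I_def)
          ultimately show False using small by (simp add: s_def)
        qed
        moreover have "4 \<le> card (verts I)" using s64 by (simp add: I_def s_def)
        ultimately obtain A u where A: "A \<subseteq> S" "u \<in> S" "card S \<le> 3 * card A"
          "3 * card A \<le> 2 * card S" "edge_boundary I A \<subseteq> {e \<in> edges I. u \<in> e}"
          using forest_balanced_cut[OF Is] by (auto simp: I_def)
        \<comment> \<open>All crossing edges share \<open>u\<close>, so the degree bound
          \<open>l\<close> limits their number.\<close>
        have "crossing_edges H A (S - A) \<subseteq> edge_boundary I A"
        proof
          fix e assume e: "e \<in> crossing_edges H A (S - A)"
          then obtain a b where ab: "a \<in> A" "a \<in> e" "b \<in> S - A" "b \<in> e" "e \<in> edges H"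
            by (auto simp: crossing_edges_def)
          moreover from this obtain x y where "e = {x, y}"
            using simple_graph_edgeE[OF Hs] by metis
          ultimately have "e = {a, b}" by auto
          moreover from this have "e \<inter> A = {a}" using ab by auto
          ultimately show "e \<in> edge_boundary I A"
            using A ab by (auto simp: edge_boundary_def I_def)
        qed
        then have "crossing_edges H A (S - A) \<subseteq> {e \<in> edges I. u \<in> e}" using A by blast
        then have "card (crossing_edges H A (S - A)) \<le> vertex_degree I u"
          unfolding vertex_degree_def using finite_edges[OF Is] by (intro card_mono) auto
        moreover have "vertex_degree I u \<le> vertex_degree G u"
          by (rule vertex_degree_subgraph_le[OF IG assms(4)])
        moreover have "real (vertex_degree G u) \<le> l"
          using degG A(2) S(1) HG by (auto simp: subgraph_def)
        \<comment> \<open>As \<open>s\<close> exceeds the square root of \<open>t\<close>, which is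
          at least \<open>w\<close>, the right-hand side is at least
          \<open>K * w = 2 * l\<^sup>2\<close>.\<close>
        moreover have "l \<le> K * s"
        proof -
          have "w \<le> s" using st wt by linarith
          then have "K * w \<le> K * s" using K0 by (rule mult_left_mono)
          moreover have "K * w = 2 * (l * l)" using w64 by (simp add: K_def power2_eq_square)
          moreover have "1 * l \<le> l * l" using l12 by (intro mult_right_mono) auto
          ultimately show ?thesis using l12 by linarith
        qed
        ultimately have "real (card (crossing_edges H A (S - A))) \<le> K * real (card S)"
          unfolding s_def by linarith
        moreover have "3 * card (S - A) \<le> 2 * card S"
          using A finS by (simp add: card_Diff_subset finite_subset)
        ultimately show ?thesis
          using A by (intro exI[of _ A] exI[of _ "S - A"]) auto
      qed
    qed
    have third: "\<mu> * real t / 3 \<le> real (card (verts H))" and "0 < \<mu> * real t"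
      using Ht \<mu> t0 \<mu>0 by auto
    obtain P where P: "finite P" "disjoint P" "\<Union>P = verts H"
      "\<forall>A\<in>P. \<mu> * real t / 3 \<le> real (card A) \<and> real (card A) \<le> \<mu> * real t"
      "(\<Sum>A\<in>P. real (card (edge_boundary H A))) \<le> real (card (edge_boundary H (verts H)))
         + 4 * K * real (card (verts H)) * log 2 (3 * real (card (verts H)) / (\<mu> * real t))"
      by (rule exE[OF partition_by_balanced_cuts[OF Hs \<open>0 < \<mu> * real t\<close> K0 cut order_refl third]],
          assumption, assumption, elim conjE, rule that)
    \<comment> \<open>The recursion starts with no boundary at all: an edge meets the whole vertex
      set in two vertices, not one.\<close>
    have "e \<notin> edge_boundary H (verts H)" for e
    proof
      assume "e \<in> edge_boundary H (verts H)"
      then have "card (e \<inter> verts H) = 1" "e \<subseteq> verts H" "card e = 2"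
        using Hs by (auto simp: edge_boundary_def simple_graph_def)
      then show False by (simp add: Int_absorb2)
    qed
    then have b0: "edge_boundary H (verts H) = {}" by blast
    \<comment> \<open>Since \<open>\<mu> \<le> 2 / 3\<close>, the cube of \<open>1 / \<mu>\<close>
      is at least 27/8 and absorbs the factor 3. The resulting 4, the 4 of the potential and the 2
      in \<open>K\<close> multiply to 32.\<close>
    have "log 2 (3 * real t / (\<mu> * real t)) \<le> 4 * log 2 (1 / \<mu>)"
    proof -
      have "(3 / 2) ^ 3 \<le> (1 / \<mu>) ^ 3"
        using \<mu> \<mu>0 by (intro power_mono) (auto simp: field_simps)
      then have "3 \<le> (1 / \<mu>) ^ 3" by (simp add: power3_eq_cube)
      then have "3 * (1 / \<mu>) \<le> (1 / \<mu>) ^ 3 * (1 / \<mu>)" using \<mu>0 by (intro mult_right_mono) auto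
      then have "3 * real t / (\<mu> * real t) \<le> (1 / \<mu>) ^ 4"
        using t0 by (simp add: power_numeral_reduce)
      then have "log 2 (3 * real t / (\<mu> * real t)) \<le> log 2 ((1 / \<mu>) ^ 4)"
        using t0 \<mu>0 by (subst log_le_cancel_iff) auto
      also have "\<dots> = 4 * log 2 (1 / \<mu>)" using \<mu>0 by (subst log_nat_power) auto
      finally show ?thesis .
    qed
    then have "4 * K * real t * log 2 (3 * real t / (\<mu> * real t)) \<le> 4 * K * real t * (4 * log 2 (1 / \<mu>))"
      using K0 by (intro mult_left_mono) auto
    also have "\<dots> = 32 * real t * L" by (simp add: K_def L_def)
    finally have bd: "(\<Sum>A\<in>P. real (card (edge_boundary H A))) \<le> 32 * real t * L"
      using P(5)[unfolded Ht b0 card.empty of_nat_0 add_0_left] by (rule order_trans[rotated])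
    obtain A where A: "disjoint_family_on A {..<nat \<lceil>1 / (4 * \<mu>)\<rceil>}"
      "\<forall>i<nat \<lceil>1 / (4 * \<mu>)\<rceil>. A i \<in> P \<and> edge_expansion H (A i) \<le> 196 * L"
      using many_parts_of_small_expansion[OF Hs P(1-3), unfolded Ht, OF P(4) bd \<mu>0 L0 Vne]
      by (elim exE conjE) (rule that)
    then show "\<exists>A :: nat \<Rightarrow> 'a set.
              disjoint_family_on A {..<nat \<lceil>1 / (4 * \<mu>)\<rceil>} \<and>
              (\<forall>i<nat \<lceil>1 / (4 * \<mu>)\<rceil>.
                 A i \<subseteq> verts H \<and>
                 \<mu> * real t / 3 \<le> real (card (A i)) \<and> real (card (A i)) \<le> \<mu> * real t \<and>
                 edge_expansion H (A i) \<le> 196 * L)"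
      using A P(3,4) by (intro exI[of _ A] conjI allI impI) (simp, blast+)
  qed
qed

end
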